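(* Let $k$ be a (commutative) field, $R$ a $k$-algebra, and $I$ a left ideal of $R$. If every element of $R$ is $k$-algebraic over $I$, then $\sqrt[\mathrm{j}]{I}$ is the largest left ideal of $R$ that is integral over $I$. In particular, $\sqrt[\mathrm{i}]{I}=\sqrt[\mathrm{j}]{I}$.
   Context: Rings and algebras are associative and unital, not necessarily commutative. For a left ideal $I$ of $R$ and $a\in R$, put $Ia^n=\{ra^n\mid r\in I\}$ and $Ia^\infty=\sum_{n\ge0}Ia^n$. An element $a\in R$ is $k$-algebraic over $I$ if $f(a)\in Ia^\infty$ for some nonzero polynomial $f(x)\in k[x]$. The Jacobson radical $\sqrt[\mathrm{j}]{I}$ of $I$ is the intersection of all maximal left ideals of $R$ containing $I$ (so it is $R$ when $I=R$). An element $a\in R$ is integral over $I$ if there exist $n\ge1$ and $r_0,\dots,r_{n-1}\in I$ with $a^n+r_{n-1}a^{n-1}+\cdots+r_1a+r_0=0$; a subset of $R$ is integral over $I$ if each of its elements is. A left ideal $J$ is integrally closed if no left ideal of $R$ properly containing $J$ is integral over $J$. The integral radical $\sqrt[\mathrm{i}]{I}$ is the intersection of all integrally closed left ideals of $R$ containing $I$. *)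

theory Defs
  imports "HOL-Computational_Algebra.Polynomial"
begin

text \<open>
  The ring \<open>R\<close> is a type of sort \<open>{ring, monoid_mult}\<close>: associative and unital, not necessarily
  commutative. The class \<^class>\<open>ring_1\<close> is not used because it excludes the zero ring.
\<close>

locale unital_algebra = vector_space scale
  for scale :: "'k::field \<Rightarrow> 'a::{ring, monoid_mult} \<Rightarrow> 'a" +
  assumes scale_mult_left: "scale c x * y = scale c (x * y)"
    and mult_scale_right: "x * scale c y = scale c (x * y)"

definition poly_eval :: "('k::field \<Rightarrow> 'a::{ring, monoid_mult} \<Rightarrow> 'a) \<Rightarrow> 'k poly \<Rightarrow> 'a \<Rightarrow> 'a" where
  "poly_eval scale f a = (\<Sum>i\<le>degree f. scale (coeff f i) (a ^ i))"

text \<open>Closure under negation follows from \<open>- x = (- 1) * x\<close>.\<close>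

definition left_ideal :: "'a::{ring, monoid_mult} set \<Rightarrow> bool" where
  "left_ideal I \<longleftrightarrow>
     0 \<in> I \<and> (\<forall>x\<in>I. \<forall>y\<in>I. x + y \<in> I) \<and> (\<forall>r. \<forall>x\<in>I. r * x \<in> I)"

definition ideal_pow :: "'a::{ring, monoid_mult} set \<Rightarrow> 'a \<Rightarrow> nat \<Rightarrow> 'a set" where
  "ideal_pow I a n = {r * a ^ n | r. r \<in> I}"

text \<open>The sum of the infinite family \<open>I a\<^sup>n\<close>, that is, the set of its finite sums.\<close>

definition ideal_pow_inf :: "'a::{ring, monoid_mult} set \<Rightarrow> 'a \<Rightarrow> 'a set" where
  "ideal_pow_inf I a = {\<Sum>n\<in>F. x n | F x. finite F \<and> (\<forall>n\<in>F. x n \<in> ideal_pow I a n)}"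

definition algebraic_over ::
    "('k::field \<Rightarrow> 'a::{ring, monoid_mult} \<Rightarrow> 'a) \<Rightarrow> 'a set \<Rightarrow> 'a \<Rightarrow> bool" where
  "algebraic_over scale I a \<longleftrightarrow> (\<exists>f. f \<noteq> 0 \<and> poly_eval scale f a \<in> ideal_pow_inf I a)"

definition maximal_left_ideal :: "'a::{ring, monoid_mult} set \<Rightarrow> bool" where
  "maximal_left_ideal M \<longleftrightarrow>
     left_ideal M \<and> M \<noteq> UNIV \<and> (\<forall>J. left_ideal J \<and> M \<subseteq> J \<longrightarrow> J = M \<or> J = UNIV)"

definition jacobson_radical :: "'a::{ring, monoid_mult} set \<Rightarrow> 'a set" where
  "jacobson_radical I = \<Inter>{M. maximal_left_ideal M \<and> I \<subseteq> M}"

definition integral_over :: "'a::{ring, monoid_mult} set \<Rightarrow> 'a \<Rightarrow> bool" where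
  "integral_over I a \<longleftrightarrow>
     (\<exists>n\<ge>1. \<exists>r. (\<forall>i<n. r i \<in> I) \<and> a ^ n + (\<Sum>i<n. r i * a ^ i) = 0)"

definition integral_set_over :: "'a::{ring, monoid_mult} set \<Rightarrow> 'a set \<Rightarrow> bool" where
  "integral_set_over I S \<longleftrightarrow> (\<forall>a\<in>S. integral_over I a)"

definition integrally_closed :: "'a::{ring, monoid_mult} set \<Rightarrow> bool" where
  "integrally_closed J \<longleftrightarrow>
     left_ideal J \<and> \<not> (\<exists>K. left_ideal K \<and> J \<subset> K \<and> integral_set_over J K)"

definition integral_radical :: "'a::{ring, monoid_mult} set \<Rightarrow> 'a set" where
  "integral_radical I = \<Inter>{J. integrally_closed J \<and> I \<subseteq> J}"

end

theory Submission imports Defs begin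

text \<open>
  Write \<open>\<J>\<close> for the Jacobson radical of \<open>I\<close>.  Two observations about congruence to \<open>1\<close>
  carry the proof.

  A left ideal \<open>K\<close> integral over \<open>I\<close> lies in every maximal left ideal \<open>M \<supseteq> I\<close>.  Otherwise
  \<open>K + M\<close> is the whole ring and some \<open>a \<in> K\<close> satisfies \<open>1 - a \<in> M\<close>.  Such an element has
  \<open>M a \<subseteq> M\<close> and all its powers are congruent to \<open>1\<close> modulo \<open>M\<close>, so an integral equation of \<open>a\<close>
  over \<open>I\<close>, read modulo \<open>M\<close>, says \<open>1 \<in> M\<close> (\<open>integral_left_ideal_subset_jacobson_radical\<close>).

  Conversely, let \<open>a \<in> \<J>\<close> be algebraic over \<open>I\<close>.  Dividing the polynomial by its lowest
  nonzero coefficient gives \<open>(1 + w a) a\<^sup>m = \<Sum>\<^sub>n r\<^sub>n a\<^sup>n\<close> with \<open>r\<^sub>n \<in> I\<close>.  The terms with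
  \<open>n \<ge> m\<close> have the form \<open>y a\<^sup>m\<close> with \<open>y \<in> \<J>\<close>, because both \<open>I\<close> and \<open>a\<close> lie in \<open>\<J>\<close>; moving them to the left
  yields \<open>(1 - b) a\<^sup>m \<in> \<Sum>\<^bsub>n<m\<^esub> I a\<^sup>n\<close> with \<open>b \<in> \<J>\<close>.  As \<open>b\<close> lies in every maximal left
  ideal above \<open>I\<close>, one can write \<open>1 = c + s (1 - b)\<close> with \<open>c \<in> I\<close>
  (\<open>one_minus_jacobson_comaximal\<close>), hence \<open>a\<^sup>m \<in> \<Sum>\<^bsub>n\<le>m\<^esub> I a\<^sup>n\<close>.  This has the
  term \<open>c a\<^sup>m\<close> of degree \<open>m\<close> on the right, but multiplying by \<open>a\<close> from the left keeps the right-hand side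
  in place and raises the power on the left: \<open>a\<^bsup>m+1\<^esup> \<in> \<Sum>\<^bsub>n\<le>m\<^esub> I a\<^sup>n\<close> is an
  integral equation.

  The equality of the two radicals is then formal.  The first observation makes \<open>\<J>\<close>
  integrally closed; the second, applied to an integrally closed \<open>Q \<supseteq> I\<close>, over which all
  elements are still algebraic, shows that \<open>Q\<close> equals its own Jacobson radical and hence
  contains \<open>\<J>\<close>.
\<close>

section \<open>Left ideals and maximal left ideals\<close>

lemma left_ideal_add: "left_ideal I \<Longrightarrow> x \<in> I \<Longrightarrow> y \<in> I \<Longrightarrow> x + y \<in> I"
  by (simp add: left_ideal_def)

lemma left_ideal_mult: "left_ideal I \<Longrightarrow> x \<in> I \<Longrightarrow> r * x \<in> I"
  by (simp add: left_ideal_def)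

lemma left_ideal_uminus: "left_ideal I \<Longrightarrow> x \<in> I \<Longrightarrow> - x \<in> I"
  using left_ideal_mult[of I x "- 1"] by (simp flip: minus_mult_left)

lemma left_ideal_diff: "left_ideal I \<Longrightarrow> x \<in> I \<Longrightarrow> y \<in> I \<Longrightarrow> x - y \<in> I"
  using left_ideal_add[of I x "- y"] left_ideal_uminus[of I y] by simp

lemma left_ideal_sum: "left_ideal I \<Longrightarrow> (\<And>i. i \<in> A \<Longrightarrow> f i \<in> I) \<Longrightarrow> sum f A \<in> I"
  by (induction A rule: infinite_finite_induct) (auto simp: left_ideal_def)

lemma left_ideal_eq_UNIV_iff: "left_ideal I \<Longrightarrow> I = UNIV \<longleftrightarrow> 1 \<in> I"
  using left_ideal_mult[of I 1] by fastforce

lemma left_ideal_Inter: "(\<And>M. M \<in> \<M> \<Longrightarrow> left_ideal M) \<Longrightarrow> left_ideal (\<Inter>\<M>)"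
  by (simp add: left_ideal_def)

lemma left_ideal_add_principal:
  assumes "left_ideal I"
  shows "left_ideal {x + r * b | x r. x \<in> I}"
  unfolding left_ideal_def
proof (intro conjI ballI allI)
  show "0 \<in> {x + r * b | x r. x \<in> I}"
    using assms by (auto simp: left_ideal_def intro!: exI[of _ 0])
next
  fix u v assume "u \<in> {x + r * b | x r. x \<in> I}" "v \<in> {x + r * b | x r. x \<in> I}"
  then obtain x r y s where "x \<in> I" "y \<in> I" "u = x + r * b" "v = y + s * b" by blast
  then have "u + v = (x + y) + (r + s) * b" "x + y \<in> I"
    using assms by (auto simp: algebra_simps left_ideal_add)
  then show "u + v \<in> {x + r * b | x r. x \<in> I}" by blast
next
  fix t u assume "u \<in> {x + r * b | x r. x \<in> I}"
  then obtain x r where "x \<in> I" "u = x + r * b" by blast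
  then have "t * u = t * x + (t * r) * b" "t * x \<in> I"
    using assms by (auto simp: algebra_simps left_ideal_mult)
  then show "t * u \<in> {x + r * b | x r. x \<in> I}" by blast
qed

lemma subset_add_principal:
  fixes b :: "'a::{ring, monoid_mult}"
  shows "I \<subseteq> {x + r * b | x r. x \<in> I}"
proof
  fix x assume "x \<in> I"
  moreover have "x = x + 0 * b" by simp
  ultimately show "x \<in> {x + r * b | x r. x \<in> I}" by blast
qed

lemma generator_in_add_principal:
  assumes "left_ideal I"
  shows "b \<in> {x + r * b | x r. x \<in> I}"
proof -
  have "b = 0 + 1 * b" "0 \<in> I" using assms by (auto simp: left_ideal_def)
  then show ?thesis by blast
qed

lemma exists_maximal_left_ideal:
  fixes I :: "'a::{ring, monoid_mult} set"
  assumes "left_ideal I" and "1 \<notin> I"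
  obtains M where "maximal_left_ideal M" and "I \<subseteq> M"
proof -
  define \<A> where "\<A> = {J. left_ideal J \<and> 1 \<notin> J \<and> I \<subseteq> J}"
  have "\<exists>M\<in>\<A>. \<forall>J\<in>\<A>. M \<subseteq> J \<longrightarrow> J = M"
  proof (rule subset_Zorn_nonempty)
    show "\<A> \<noteq> {}" using assms by (auto simp: \<A>_def)
  next
    fix \<C> assume "\<C> \<noteq> {}" and chain: "subset.chain \<A> \<C>"
    then obtain C where C: "C \<in> \<C>" by blast
    from chain have sub: "\<C> \<subseteq> \<A>" and lin: "\<And>X Y. X \<in> \<C> \<Longrightarrow> Y \<in> \<C> \<Longrightarrow> X \<subseteq> Y \<or> Y \<subseteq> X"
      by (auto simp: subset_chain_def)
    have "left_ideal (\<Union>\<C>)"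
      unfolding left_ideal_def
    proof (intro conjI ballI allI)
      show "0 \<in> \<Union>\<C>" using C sub by (auto simp: \<A>_def left_ideal_def)
    next
      fix x y assume "x \<in> \<Union>\<C>" "y \<in> \<Union>\<C>"
      then obtain Z where "Z \<in> \<C>" "x \<in> Z" "y \<in> Z" using lin by blast
      moreover from this sub have "left_ideal Z" by (auto simp: \<A>_def)
      ultimately show "x + y \<in> \<Union>\<C>" using left_ideal_add by blast
    next
      fix r x assume "x \<in> \<Union>\<C>"
      then obtain Z where "Z \<in> \<C>" "x \<in> Z" by blast
      moreover from this sub have "left_ideal Z" by (auto simp: \<A>_def)
      ultimately show "r * x \<in> \<Union>\<C>" using left_ideal_mult by blast
    qed
    then show "\<Union>\<C> \<in> \<A>" using C sub by (auto simp: \<A>_def)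
  qed
  then obtain M where M: "M \<in> \<A>" and max: "\<And>J. J \<in> \<A> \<Longrightarrow> M \<subseteq> J \<Longrightarrow> J = M" by blast
  have "J = M \<or> J = UNIV" if "left_ideal J" "M \<subseteq> J" for J
    using that M max[of J] left_ideal_eq_UNIV_iff[of J] by (auto simp: \<A>_def)
  with M have "maximal_left_ideal M" by (auto simp: \<A>_def maximal_left_ideal_def)
  with M that show thesis by (auto simp: \<A>_def)
qed

lemma maximal_left_ideal_comaximal:
  assumes "maximal_left_ideal M" and "b \<notin> M"
  obtains m r where "m \<in> M" and "1 = m + r * b"
proof -
  let ?J = "{x + r * b | x r. x \<in> M}"
  have M: "left_ideal M" using assms by (simp add: maximal_left_ideal_def)
  have "M \<subseteq> ?J" by (rule subset_add_principal)
  moreover have "b \<in> ?J" by (rule generator_in_add_principal[OF M])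
  ultimately have "?J = UNIV"
    using assms left_ideal_add_principal[OF M, of b] unfolding maximal_left_ideal_def by blast
  then have "1 \<in> ?J" by simp
  with that show thesis by blast
qed

section \<open>The Jacobson radical of a left ideal\<close>

lemma left_ideal_jacobson_radical: "left_ideal (jacobson_radical I)"
  unfolding jacobson_radical_def by (rule left_ideal_Inter) (simp add: maximal_left_ideal_def)

lemma subset_jacobson_radical: "I \<subseteq> jacobson_radical I"
  by (auto simp: jacobson_radical_def)

lemma jacobson_radical_mono: "I \<subseteq> J \<Longrightarrow> jacobson_radical I \<subseteq> jacobson_radical J"
  by (auto simp: jacobson_radical_def)

lemma jacobson_radical_idem: "jacobson_radical (jacobson_radical I) = jacobson_radical I"
  by (auto simp: jacobson_radical_def)

text \<open>
  This is the one-sided analogue, relative to \<open>I\<close>, of the fact that \<open>1 - b\<close> is left invertible for \<open>b\<close> in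
  the Jacobson radical: a maximal left ideal containing \<open>I\<close> and \<open>1 - b\<close> would contain \<open>1\<close>.
\<close>

lemma one_minus_jacobson_comaximal:
  assumes I: "left_ideal I" and b: "b \<in> jacobson_radical I"
  obtains c s where "c \<in> I" and "1 = c + s * (1 - b)"
proof -
  let ?J = "{x + r * (1 - b) | x r. x \<in> I}"
  have J: "left_ideal ?J" by (rule left_ideal_add_principal[OF I])
  have "I \<subseteq> ?J" by (rule subset_add_principal)
  have "1 - b \<in> ?J" by (rule generator_in_add_principal[OF I])
  have "1 \<in> ?J"
  proof (rule ccontr)
    assume "1 \<notin> ?J"
    then obtain M where M: "maximal_left_ideal M" "?J \<subseteq> M"
      using exists_maximal_left_ideal[OF J] by blast
    with b \<open>I \<subseteq> ?J\<close> have "b \<in> M" unfolding jacobson_radical_def by blast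
    moreover have "1 - b \<in> M" using M \<open>1 - b \<in> ?J\<close> by blast
    ultimately have "1 \<in> M"
      using M left_ideal_add[of M "1 - b" b] by (simp add: maximal_left_ideal_def)
    with M show False
      using left_ideal_eq_UNIV_iff[of M] by (simp add: maximal_left_ideal_def)
  qed
  with that show thesis by blast
qed

section \<open>Integral left ideals lie in the Jacobson radical\<close>

text \<open>
  The element \<open>a = r b\<close> of \<open>J\<close> below is congruent to \<open>1\<close> modulo \<open>M\<close>.  Right multiplication by \<open>a\<close> then
  induces the identity modulo \<open>M\<close>, although \<open>M\<close> is only a left ideal: \<open>x - x a = x (1 - a)\<close>
  for every \<open>x\<close>.
\<close>

lemma integral_left_ideal_subset_jacobson_radical:
  assumes J: "left_ideal J" and int: "integral_set_over I J"
  shows "J \<subseteq> jacobson_radical I"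
proof (rule ccontr)
  assume "\<not> J \<subseteq> jacobson_radical I"
  then obtain b M where b: "b \<in> J" "b \<notin> M" and M: "maximal_left_ideal M" "I \<subseteq> M"
    by (auto simp: jacobson_radical_def)
  have lM: "left_ideal M" using M by (simp add: maximal_left_ideal_def)
  obtain m r where m: "m \<in> M" "1 = m + r * b"
    using maximal_left_ideal_comaximal[OF M(1) b(2)] by blast
  define a where "a = r * b"
  have m_eq: "m = 1 - a" using m(2) by (simp add: a_def eq_diff_eq)
  have step: "x - x * a \<in> M" for x
    using left_ideal_mult[OF lM m(1), of x] by (simp add: m_eq right_diff_distrib)
  have cong: "x - x * a ^ n \<in> M" for x n
  proof (induction n)
    case 0
    show ?case using lM by (simp add: left_ideal_def)
  next
    case (Suc n)
    have "x - x * a ^ Suc n = (x - x * a ^ n) + (x * a ^ n - x * a ^ n * a)"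
      by (simp only: power_Suc2 mult.assoc) simp
    also have "\<dots> \<in> M" by (rule left_ideal_add[OF lM Suc step])
    finally show ?case .
  qed
  have stable: "x * a ^ n \<in> M" if "x \<in> M" for x n
    using left_ideal_diff[OF lM that cong[of x n]] by simp
  have "a \<in> J" using left_ideal_mult[OF J b(1)] by (simp add: a_def)
  then obtain n q where q: "\<forall>i<n. q i \<in> I" "a ^ n + (\<Sum>i<n. q i * a ^ i) = 0"
    using int unfolding integral_set_over_def integral_over_def by blast
  have "(\<Sum>i<n. q i * a ^ i) \<in> M"
    using q(1) M(2) by (intro left_ideal_sum[OF lM] stable) auto
  moreover have "a ^ n = - (\<Sum>i<n. q i * a ^ i)"
    using q(2) by (simp add: eq_neg_iff_add_eq_0)
  ultimately have "a ^ n \<in> M" using left_ideal_uminus[OF lM] by simp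
  then have "1 \<in> M" using left_ideal_add[OF lM cong[of 1 n]] by fastforce
  with M lM show False using left_ideal_eq_UNIV_iff[of M] by (simp add: maximal_left_ideal_def)
qed

section \<open>Algebraic elements of the Jacobson radical are integral\<close>

text \<open>
  Here \<open>m\<close> is the order of vanishing at \<open>0\<close> of the polynomial; dividing by its coefficient at
  \<open>m\<close> keeps the right-hand side in \<open>I a\<^sup>\<infinity>\<close>, since scalars act as left multiplications.
\<close>

lemma algebraic_over_normal_form:
  assumes alg: "unital_algebra scale" and I: "left_ideal I" and "algebraic_over scale I a"
  obtains m w r F where "finite F" and "\<And>n. n \<in> F \<Longrightarrow> r n \<in> I"
    and "(1 + w * a) * a ^ m = (\<Sum>n\<in>F. r n * a ^ n)"
proof -
  interpret unital_algebra scale by (rule alg)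
  obtain f where f: "f \<noteq> 0" "poly_eval scale f a \<in> ideal_pow_inf I a"
    using assms by (auto simp: algebraic_over_def)
  obtain F x where F: "finite F" "poly_eval scale f a = (\<Sum>n\<in>F. x n)"
    and x: "\<forall>n\<in>F. x n \<in> ideal_pow I a n"
    using f(2) unfolding ideal_pow_inf_def by blast
  obtain r where r: "\<And>n. n \<in> F \<Longrightarrow> r n \<in> I \<and> x n = r n * a ^ n"
    using x unfolding ideal_pow_def mem_Collect_eq by metis
  define m where "m = (LEAST i. coeff f i \<noteq> 0)"
  define c where "c = coeff f m"
  define e where "e = scale (inverse c) 1"
  have "\<exists>i. coeff f i \<noteq> 0" using f(1) by (meson leading_coeff_0_iff)
  then have "c \<noteq> 0" unfolding c_def m_def by (rule LeastI_ex)
  have low: "coeff f i = 0" if "i < m" for i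
    using that not_less_Least[of i "\<lambda>i. coeff f i \<noteq> 0"] by (auto simp: m_def)
  have "m \<le> degree f" using \<open>c \<noteq> 0\<close> by (simp add: c_def le_degree)
  define w where "w = (\<Sum>i\<in>{m<..degree f}. scale (inverse c * coeff f i) (a ^ (i - Suc m)))"
  have "e * poly_eval scale f a = scale (inverse c) (poly_eval scale f a)"
    by (simp add: e_def scale_mult_left)
  also have "\<dots> = (\<Sum>i\<le>degree f. scale (inverse c * coeff f i) (a ^ i))"
    by (simp add: poly_eval_def scale_sum_right)
  also have "\<dots> = (\<Sum>i\<in>insert m {m<..degree f}. scale (inverse c * coeff f i) (a ^ i))"
    using \<open>m \<le> degree f\<close> low by (intro sum.mono_neutral_right) auto
  also have "\<dots> = a ^ m + (\<Sum>i\<in>{m<..degree f}. scale (inverse c * coeff f i) (a ^ i))"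
    using \<open>c \<noteq> 0\<close> by (simp flip: c_def)
  also have "(\<Sum>i\<in>{m<..degree f}. scale (inverse c * coeff f i) (a ^ i)) = w * a * a ^ m"
    unfolding w_def sum_distrib_right
  proof (intro sum.cong refl)
    fix i assume "i \<in> {m<..degree f}"
    then have "a ^ i = a ^ (i - Suc m) * a * a ^ m"
      by (simp add: mult.assoc flip: power_Suc power_add)
    then show "scale (inverse c * coeff f i) (a ^ i) =
        scale (inverse c * coeff f i) (a ^ (i - Suc m)) * a * a ^ m"
      by (simp add: scale_mult_left)
  qed
  finally have "(1 + w * a) * a ^ m = e * (\<Sum>n\<in>F. x n)"
    using F(2) by (simp add: distrib_right)
  also have "\<dots> = (\<Sum>n\<in>F. (e * r n) * a ^ n)"
    using r by (simp add: sum_distrib_left mult.assoc)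
  finally have "(1 + w * a) * a ^ m = (\<Sum>n\<in>F. (e * r n) * a ^ n)" .
  with that[OF F(1), of "\<lambda>n. e * r n"] r I show thesis
    by (auto simp: left_ideal_mult)
qed

text \<open>
  Multiplying \<open>1 = c + s u\<close> by \<open>a\<^sup>m\<close> gives \<open>a\<^sup>m \<in> \<Sum>\<^bsub>n\<le>m\<^esub> I a\<^sup>n\<close>, one degree short of an integral
  equation.  A further left factor \<open>a\<close>, absorbed on the right-hand side because \<open>a I \<subseteq> I\<close>, makes the equation
  integral of degree \<open>m + 1\<close>.
\<close>

lemma integral_over_if_comaximal:
  assumes I: "left_ideal I" and c: "c \<in> I" and one: "1 = c + s * u"
    and t: "\<And>n. n < m \<Longrightarrow> t n \<in> I" and u: "u * a ^ m = (\<Sum>n<m. t n * a ^ n)"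
  shows "integral_over I a"
proof -
  define q where "q n = - (a * (if n = m then c else s * t n))" for n
  have "a ^ Suc m = a * ((c + s * u) * a ^ m)"
    by (simp flip: one)
  also have "\<dots> = a * (c * a ^ m) + a * (s * (u * a ^ m))"
    by (simp add: distrib_left distrib_right mult.assoc)
  also have "\<dots> = a * (c * a ^ m) + (\<Sum>n<m. a * (s * (t n * a ^ n)))"
    by (simp add: u sum_distrib_left)
  also have "\<dots> = - (\<Sum>n<Suc m. q n * a ^ n)"
    by (simp add: q_def mult.assoc sum_negf)
  finally have "a ^ Suc m + (\<Sum>n<Suc m. q n * a ^ n) = 0"
    by (simp only: eq_neg_iff_add_eq_0)
  moreover have "\<forall>n<Suc m. q n \<in> I"
    using I c t by (auto simp: q_def less_Suc_eq intro!: left_ideal_uminus left_ideal_mult)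
  ultimately show ?thesis
    unfolding integral_over_def by (intro exI[of _ "Suc m"]) auto
qed

lemma integral_over_if_algebraic_in_jacobson_radical:
  assumes alg: "unital_algebra scale" and I: "left_ideal I"
    and "algebraic_over scale I a" and a: "a \<in> jacobson_radical I"
  shows "integral_over I a"
proof -
  let ?J = "jacobson_radical I"
  note J = left_ideal_jacobson_radical[of I]
  obtain m w r F where F: "finite F" and r: "\<And>n. n \<in> F \<Longrightarrow> r n \<in> I"
    and eq: "(1 + w * a) * a ^ m = (\<Sum>n\<in>F. r n * a ^ n)"
    using algebraic_over_normal_form[OF assms(1-3)] by metis
  define y where "y = (\<Sum>n\<in>F \<inter> {m..}. r n * a ^ (n - m))"
  have "r n * a ^ k \<in> ?J" if "n \<in> F" for n k
  proof (cases k)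
    case 0
    then show ?thesis using r[OF that] subset_jacobson_radical by auto
  next
    case (Suc l)
    then have "r n * a ^ k = (r n * a ^ l) * a" by (simp only: power_Suc2 mult.assoc)
    then show ?thesis using left_ideal_mult[OF J a] by simp
  qed
  then have "y \<in> ?J" unfolding y_def by (intro left_ideal_sum[OF J]) auto
  then have "y - w * a \<in> ?J" by (intro left_ideal_diff[OF J] left_ideal_mult[OF J a])
  then obtain c s where c: "c \<in> I" and one: "1 = c + s * (1 - (y - w * a))"
    using one_minus_jacobson_comaximal[OF I] by blast
  define t where "t n = (if n \<in> F then r n else 0)" for n
  have "(\<Sum>n\<in>F. r n * a ^ n) =
      (\<Sum>n\<in>F \<inter> {m..}. r n * a ^ n) + (\<Sum>n\<in>F \<inter> {..<m}. r n * a ^ n)"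
    using F by (subst sum.union_disjoint[symmetric]) (auto intro!: sum.cong)
  also have "(\<Sum>n\<in>F \<inter> {m..}. r n * a ^ n) = y * a ^ m"
    unfolding y_def sum_distrib_right
    by (intro sum.cong refl) (simp add: mult.assoc flip: power_add)
  also have "(\<Sum>n\<in>F \<inter> {..<m}. r n * a ^ n) = (\<Sum>n<m. t n * a ^ n)"
    by (rule sum.mono_neutral_cong_left) (auto simp: t_def)
  finally have "(1 - (y - w * a)) * a ^ m = (\<Sum>n<m. t n * a ^ n)"
    using eq by (simp add: left_diff_distrib distrib_right algebra_simps)
  moreover have "t n \<in> I" for n using r I by (auto simp: t_def left_ideal_def)
  ultimately show ?thesis using integral_over_if_comaximal[OF I c one] by blast
qed

section \<open>Comparison of the two radicals\<close>

lemma algebraic_over_mono: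
  assumes "I \<subseteq> J" and "algebraic_over scale I a"
  shows "algebraic_over scale J a"
proof -
  have "ideal_pow I a n \<subseteq> ideal_pow J a n" for n
    using assms(1) by (auto simp: ideal_pow_def)
  then have "ideal_pow_inf I a \<subseteq> ideal_pow_inf J a"
    unfolding ideal_pow_inf_def by blast
  with assms(2) show ?thesis unfolding algebraic_over_def by blast
qed

lemma integrally_closed_jacobson_radical: "integrally_closed (jacobson_radical I)"
  using integral_left_ideal_subset_jacobson_radical[of _ "jacobson_radical I"]
  by (auto simp: integrally_closed_def left_ideal_jacobson_radical jacobson_radical_idem)

theorem corollary4p8:
  fixes scale :: "'k::field \<Rightarrow> 'a::{ring, monoid_mult} \<Rightarrow> 'a"
    and I :: "'a set"
  assumes "unital_algebra scale"
    and "left_ideal I"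
    and "\<forall>a. algebraic_over scale I a"
  shows "(left_ideal (jacobson_radical I) \<and> integral_set_over I (jacobson_radical I) \<and>
           (\<forall>J. left_ideal J \<and> integral_set_over I J \<longrightarrow> J \<subseteq> jacobson_radical I)) \<and>
         integral_radical I = jacobson_radical I"
proof -
  have int: "integral_set_over Q (jacobson_radical Q)" if "left_ideal Q" "I \<subseteq> Q" for Q
    unfolding integral_set_over_def
    using integral_over_if_algebraic_in_jacobson_radical[OF assms(1) that(1)]
      algebraic_over_mono[OF that(2)] assms(3) by blast
  have "jacobson_radical I \<subseteq> Q" if Q: "integrally_closed Q" "I \<subseteq> Q" for Q
  proof -
    have "left_ideal Q" using Q by (simp add: integrally_closed_def)
    then have "\<not> Q \<subset> jacobson_radical Q"
      using Q int[of Q] left_ideal_jacobson_radical unfolding integrally_closed_def by blast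
    then show ?thesis
      using jacobson_radical_mono[OF Q(2)] subset_jacobson_radical[of Q] by blast
  qed
  then have "jacobson_radical I \<subseteq> integral_radical I" unfolding integral_radical_def by blast
  moreover have "integral_radical I \<subseteq> jacobson_radical I"
    using integrally_closed_jacobson_radical subset_jacobson_radical
    unfolding integral_radical_def by blast
  ultimately show ?thesis
    using int[OF assms(2)] left_ideal_jacobson_radical
      integral_left_ideal_subset_jacobson_radical by blast
qed

end
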